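(* Let $q$ be a prime power, $n\ge 1$ an integer, and $H(x)\in\mathbb{F}_{q^n}[x]$. Let $P_H=\{\gamma\in\mathbb{F}_{q^n} : x+\gamma\,\mathrm{Tr}(H(x)) \text{ is a permutation polynomial over } \mathbb{F}_{q^n}\}$, let $S=\{\mathrm{Tr}(H(x)) : x\in\mathbb{F}_{q^n}\}\subseteq\mathbb{F}_q$, and for $b\in S$ let $I_b=\{x\in\mathbb{F}_{q^n} : \mathrm{Tr}(H(x))=b\}$. Then $$P_H=\mathbb{F}_{q^n}\setminus\bigcup_{\substack{b,c\in S\\ b\ne c}}\left\{\frac{y-x}{b-c} : x\in I_b,\ y\in I_c\right\}.$$
   Context: $\mathrm{Tr}:\mathbb{F}_{q^n}\to\mathbb{F}_q$ is the trace map $\mathrm{Tr}(x)=x+x^q+\cdots+x^{q^{n-1}}$. A polynomial $f$ over $\mathbb{F}_{q^n}$ is a permutation polynomial if the map $x\mapsto f(x)$ is a bijection of $\mathbb{F}_{q^n}$ onto itself. *)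

theory Defs
  imports
    "HOL-Computational_Algebra.Polynomial"
    "HOL-Number_Theory.Prime_Powers"
    "HOL-Library.Cardinality"
begin

text \<open>
  Throughout, the field \<open>\<F>\<close> with \<open>q ^ n\<close> elements is a type \<open>'a :: finite_field\<close> with
  \<open>CARD('a) = q ^ n\<close>. Its subfield with \<open>q\<close> elements is the set of fixed points of
  \<open>\<lambda>x. x ^ q\<close>.
\<close>

definition subfield_of_order :: "nat \<Rightarrow> 'a :: finite_field set" where
  "subfield_of_order q = {x. x ^ q = x}"

text \<open>
  The sum is stated over an arbitrary commutative semiring so that the trace map on the field
  and the polynomial \<open>Tr(H(x))\<close>, for a polynomial \<open>H\<close>, are instances of the same expression
  (see \<open>poly_Tr\<close> below).
\<close>

definition Tr :: "nat \<Rightarrow> nat \<Rightarrow> 'a :: comm_semiring_1 \<Rightarrow> 'a" where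
  "Tr q n x = (\<Sum>i<n. x ^ (q ^ i))"

definition permutation_polynomial :: "'a :: finite_field poly \<Rightarrow> bool" where
  "permutation_polynomial f \<longleftrightarrow> bij (poly f)"

definition P_set :: "nat \<Rightarrow> nat \<Rightarrow> 'a :: finite_field poly \<Rightarrow> 'a set" where
  "P_set q n H = {\<gamma>. permutation_polynomial ([:0, 1:] + smult \<gamma> (Tr q n H))}"

definition S_set :: "nat \<Rightarrow> nat \<Rightarrow> 'a :: finite_field poly \<Rightarrow> 'a set" where
  "S_set q n H = {Tr q n (poly H x) | x. True}"

definition I_set :: "nat \<Rightarrow> nat \<Rightarrow> 'a :: finite_field poly \<Rightarrow> 'a \<Rightarrow> 'a set" where
  "I_set q n H b = {x. Tr q n (poly H x) = b}"

lemma poly_Tr: "poly (Tr q n H) x = Tr q n (poly H x)"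
  by (simp add: Tr_def poly_sum)

lemma poly_shifted_Tr:
  "poly ([:0, 1:] + smult \<gamma> (Tr q n H)) x = x + \<gamma> * Tr q n (poly H x)"
  by (simp add: poly_Tr)

lemma Tr_in_subfield:
  fixes x :: "'a :: finite_field"
  assumes "primepow q" "n \<ge> 1" "CARD('a) = q ^ n"
  shows "Tr q n x \<in> subfield_of_order q"
proof -
  obtain p k where pk: "prime p" "k > 0" "q = p ^ k"
    using assms(1) by (auto simp: primepow_def)
  have prime_char: "prime CHAR('a)"
    by simp
  have "CHAR('a) dvd q ^ n"
  proof -
    have "(\<Sum>y\<in>(UNIV :: 'a set). y) = (\<Sum>y\<in>UNIV. y + 1)"
      by (rule sum.reindex_bij_witness[of _ "\<lambda>y. y + 1" "\<lambda>y. y - 1"]) auto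
    hence "of_nat (CARD('a)) = (0 :: 'a)"
      by (simp add: sum.distrib)
    thus ?thesis
      using assms(3) by (simp only: of_nat_eq_0_iff_char_dvd)
  qed
  hence "CHAR('a) dvd p"
    using pk prime_char prime_dvd_power by (metis power_mult)
  hence "q = CHAR('a) ^ k"
    using pk prime_char by (metis primes_dvd_imp_eq)
  hence "Tr q n x ^ q = (\<Sum>i<n. (x ^ (q ^ i)) ^ q)"
    unfolding Tr_def by (intro freshmans_dream_sum') auto
  also have "\<dots> = (\<Sum>i<n. x ^ (q ^ Suc i))"
    by (simp add: power_mult [symmetric] mult.commute)
  also have "\<dots> = Tr q n x"
  proof -
    have "x ^ (q ^ n) = x"
      using finite_field_power_card_eq_same[of x] assms(3) by simp
    moreover have "(\<Sum>i<n. x ^ (q ^ Suc i)) + x = (\<Sum>i<n. x ^ (q ^ i)) + x ^ (q ^ n)"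
      using sum.lessThan_Suc_shift[of "\<lambda>i. x ^ (q ^ i)" n]
      by (simp add: add.commute)
    ultimately show ?thesis
      by (simp add: Tr_def)
  qed
  finally show ?thesis
    by (simp add: subfield_of_order_def)
qed

lemma S_set_subset:
  fixes H :: "'a :: finite_field poly"
  assumes "primepow q" "n \<ge> 1" "CARD('a) = q ^ n"
  shows "S_set q n H \<subseteq> subfield_of_order q"
  using Tr_in_subfield[OF assms] by (auto simp: S_set_def)

end

theory Submission
  imports Defs
begin

text \<open>Write t(x) = Tr(H(x)). A self-map of a finite field is bijective iff it is injective, so
  \<gamma> fails to lie in \<open>P_set q n H\<close> exactly when two distinct points collide under
  x + \<gamma> t(x). A collision means \<gamma> (t(x) - t(y)) = y - x: equal values of t force x =
  y, while unequal values determine \<gamma> as (y - x) / (t(x) - t(y)). The lemma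
  \<open>inj_add_mult_iff\<close> carries this out for an arbitrary function t.\<close>

lemma inj_add_mult_iff:
  fixes t :: "'a :: field \<Rightarrow> 'a"
  shows "inj (\<lambda>x. x + \<gamma> * t x) \<longleftrightarrow>
    (\<forall>x y. t x \<noteq> t y \<longrightarrow> \<gamma> \<noteq> (y - x) / (t x - t y))"
proof -
  have collision: "x + \<gamma> * t x = y + \<gamma> * t y \<longleftrightarrow> \<gamma> = (y - x) / (t x - t y)"
    if "t x \<noteq> t y" for x y
    using that by (auto simp: field_simps)
  show ?thesis
  proof
    assume "inj (\<lambda>x. x + \<gamma> * t x)"
    \<comment> \<open>Distinct values of \<open>t\<close> force x and y to be distinct, so a
      quotient equal to \<gamma> would give a genuine collision.\<close>
    then show "\<forall>x y. t x \<noteq> t y \<longrightarrow> \<gamma> \<noteq> (y - x) / (t x - t y)"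
      by (metis collision injD)
  next
    assume no_quotient: "\<forall>x y. t x \<noteq> t y \<longrightarrow> \<gamma> \<noteq> (y - x) / (t x - t y)"
    show "inj (\<lambda>x. x + \<gamma> * t x)"
    proof (rule injI)
      fix x y
      assume eq: "x + \<gamma> * t x = y + \<gamma> * t y"
      then have "t x = t y"
        using collision no_quotient by blast
      with eq show "x = y"
        by simp
    qed
  qed
qed

text \<open>Finiteness of the field makes surjectivity follow from injectivity.\<close>

lemma permutation_polynomial_shifted_Tr_iff:
  "permutation_polynomial ([:0, 1:] + smult \<gamma> (Tr q n H)) \<longleftrightarrow>
    inj (\<lambda>x. x + \<gamma> * Tr q n (poly H x))"
  unfolding permutation_polynomial_def bij_def poly_shifted_Tr
  using finite_UNIV_inj_surj[OF finite] by blast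

theorem theorem2p1:
  fixes q n :: nat and H :: "'a :: finite_field poly"
  assumes "primepow q" and "n \<ge> 1" and "CARD('a) = q ^ n"
  shows "P_set q n H =
    UNIV - (\<Union>(b, c) \<in> {(b, c). b \<in> S_set q n H \<and> c \<in> S_set q n H \<and> b \<noteq> c}.
      {(y - x) / (b - c) | x y. x \<in> I_set q n H b \<and> y \<in> I_set q n H c})"
proof -
  let ?t = "\<lambda>x. Tr q n (poly H x)"
  \<comment> \<open>Each point lies in exactly one level set, the one indexed by its own value
    \<open>?t x\<close>, so the union over b and c collapses to pairs of points with distinct
    values.\<close>
  have "(\<Union>(b, c) \<in> {(b, c). b \<in> S_set q n H \<and> c \<in> S_set q n H \<and> b \<noteq> c}.
      {(y - x) / (b - c) | x y. x \<in> I_set q n H b \<and> y \<in> I_set q n H c}) =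
    {(y - x) / (?t x - ?t y) | x y. ?t x \<noteq> ?t y}"
    unfolding S_set_def I_set_def by (simp add: set_eq_iff) metis
  then show ?thesis
    unfolding P_set_def permutation_polynomial_shifted_Tr_iff inj_add_mult_iff
    by auto
qed

end
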